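(* Let $k\ge 1$ and $l\ge 0$ be integers such that either $k$ is even and $l$ is odd, or $k$ is odd and $l$ is even, and put $d=\frac{3k}{2}+\frac{l+1}{2}$. Let $C\in\mathcal{F}(d,k,k+l)$ have length $N>2d=3k+(l+1)$, and let $T=(\tau_1,\ldots,\tau_N)$ be its transition sequence. Then $\xi(C)=k+1$. Furthermore, for any segment $\hat{T}=(\tau_{r+1},\ldots,\tau_{r+2k+l+1})$ of $T$ such that $\tau_{r+1},\ldots,\tau_{r+k+l}$ are all distinct, one has $\delta(\hat{T})=k$, and all $d=\frac{3k}{2}+\frac{l+1}{2}$ transition elements appear in $\hat{T}$.
   Context: $I(d)$ is the graph of the $d$-dimensional hypercube (vertices are binary vectors of length $d$; edges join vectors differing in exactly one position). For a graph $G$, $d_G(x,y)$ is the graph distance in $G$. A circuit in $I(d)$ is a simple cycle $C=(x_1,\ldots,x_N)$ in $I(d)$; its length is $N$. A $(d,k)$ circuit code (circuit code of spread $k$ in dimension $d$) is a circuit $C$ in $I(d)$ such that for all vertices $x,y$ of $C$, $d_{I(d)}(x,y)<k$ implies $d_C(x,y)=d_{I(d)}(x,y)$. The transition sequence of $C$ is $T=(\tau_1,\ldots,\tau_N)$, where $\tau_i\in\{1,\ldots,d\}$ is the position in which $x_i$ and $x_{i+1}$ differ (indices are taken mod $N$). The transition elements are the coordinates $1,\ldots,d$. A segment of $T$ is a subsequence of cyclically consecutive elements of $T$. For a segment $\hat{T}$, $\delta(\hat{T})$ is the number of transition elements that appear an odd number of times in $\hat{T}$. The maximum bit run $\phi(C)$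 is the length of the longest segment of $T$ in which no transition is repeated. The minimum bit run $\xi(C)$ is the largest $m$ such that every segment of $T$ of length $m$ consists of pairwise distinct transitions. $\mathcal{F}(d,k,r)$ is the set of $(d,k)$ circuit codes $C$ with $\phi(C)\ge r$. *)

theory Defs
  imports Complex_Main "HOL-Library.FuncSet"
begin

text \<open>A graph is given by its symmetric adjacency relation. \<open>LEAST\<close> is only meaningful for
  connected pairs, which is always the case below (the hypercube and cycles are connected).\<close>

definition graph_dist :: "('a \<times> 'a) set \<Rightarrow> 'a \<Rightarrow> 'a \<Rightarrow> nat" where
  "graph_dist E x y = (LEAST n. (x, y) \<in> E ^^ n)"

text \<open>Binary vectors of length \<open>d\<close> are extensional functions on the coordinates \<open>{1..d}\<close>, so that
  two of them can only differ at positions in \<open>{1..d}\<close>.\<close>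

definition binary_vectors :: "nat \<Rightarrow> (nat \<Rightarrow> nat) set" where
  "binary_vectors d = {1..d} \<rightarrow>\<^sub>E {0, 1}"

definition hypercube :: "nat \<Rightarrow> ((nat \<Rightarrow> nat) \<times> (nat \<Rightarrow> nat)) set" where
  "hypercube d = {(x, y). x \<in> binary_vectors d \<and> y \<in> binary_vectors d \<and> (\<exists>!p. x p \<noteq> y p)}"

text \<open>A cycle \<open>(x\<^sub>1, \<dots>, x\<^sub>N)\<close> is the list of its vertices; \<open>rotate1\<close> supplies the cyclic successors,
  so the list below consists of the pairs \<open>(x\<^sub>i, x\<^sub>i\<^sub>+\<^sub>1)\<close> with indices mod \<open>N\<close>.\<close>

definition cyclic_steps :: "'a list \<Rightarrow> ('a \<times> 'a) list" where
  "cyclic_steps C = zip C (rotate1 C)"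

definition cycle_graph :: "'a list \<Rightarrow> ('a \<times> 'a) set" where
  "cycle_graph C = set (cyclic_steps C) \<union> (set (cyclic_steps C))\<inverse>"

definition circuit :: "nat \<Rightarrow> (nat \<Rightarrow> nat) list \<Rightarrow> bool" where
  "circuit d C \<longleftrightarrow> 3 \<le> length C \<and> distinct C \<and> set (cyclic_steps C) \<subseteq> hypercube d"

definition circuit_code :: "nat \<Rightarrow> nat \<Rightarrow> (nat \<Rightarrow> nat) list \<Rightarrow> bool" where
  "circuit_code d k C \<longleftrightarrow> circuit d C \<and>
     (\<forall>x\<in>set C. \<forall>y\<in>set C. graph_dist (hypercube d) x y < k \<longrightarrow>
        graph_dist (cycle_graph C) x y = graph_dist (hypercube d) x y)"

definition transitions :: "(nat \<Rightarrow> nat) list \<Rightarrow> nat list" where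
  "transitions C = map (\<lambda>(x, y). THE p. x p \<noteq> y p) (cyclic_steps C)"

text \<open>For \<open>m \<le> length T\<close>, \<open>segment T r m\<close> is \<open>(\<tau>\<^sub>r\<^sub>+\<^sub>1, \<dots>, \<tau>\<^sub>r\<^sub>+\<^sub>m)\<close> with indices mod \<open>length T\<close>; segments
  longer than \<open>T\<close> do not exist.\<close>

definition segment :: "'a list \<Rightarrow> nat \<Rightarrow> nat \<Rightarrow> 'a list" where
  "segment T r m = take m (rotate r T)"

definition odd_count :: "'a list \<Rightarrow> nat" where
  "odd_count S = card {t. odd (count_list S t)}"

definition max_bit_run :: "(nat \<Rightarrow> nat) list \<Rightarrow> nat" where
  "max_bit_run C = Max {m. m \<le> length C \<and> (\<exists>r. distinct (segment (transitions C) r m))}"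

definition min_bit_run :: "(nat \<Rightarrow> nat) list \<Rightarrow> nat" where
  "min_bit_run C = Max {m. m \<le> length C \<and> (\<forall>r. distinct (segment (transitions C) r m))}"

definition code_family :: "nat \<Rightarrow> nat \<Rightarrow> nat \<Rightarrow> (nat \<Rightarrow> nat) list set" where
  "code_family d k r = {C. circuit_code d k C \<and> max_bit_run C \<ge> r}"

end

theory Submission
  imports Defs "HOL-Number_Theory.Cong"
begin

text \<open>Two vertices of a spread-\<open>k\<close> code that are at least \<open>k\<close> apart along the circuit are at least
  \<open>k\<close> apart in the cube, so \<open>\<delta>(S) \<ge> k\<close> for every segment \<open>S\<close> with \<open>k \<le> length S \<le> N - k\<close>. Since
  \<open>\<delta>(S)\<close> and \<open>length S\<close> have the same parity, segments of length \<open>k + 1\<close> are repetition-free. If a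
  segment splits into two repetition-free pieces \<open>A\<close>, \<open>B\<close>, then
  \<open>\<delta>(AB) + \<bar>A\<bar> + \<bar>B\<bar> = 2 \<bar>set A \<union> set B\<bar> \<le> 2 d = 3 k + l + 1\<close>. For \<open>\<bar>A\<bar> = k + l\<close> and \<open>\<bar>B\<bar> = k + 1\<close> this
  forces \<open>\<delta>(AB) = k\<close> and \<open>set A \<union> set B = {1..d}\<close>; for \<open>\<bar>B\<bar> = k + 2\<close> it gives \<open>\<delta>(AB) < k\<close>, so some
  segment of length \<open>k + 2\<close> has a repetition.\<close>

section \<open>Parity counts of lists\<close>

lemma odd_count_set_subset: "{t. odd (count_list S t)} \<subseteq> set S"
  using count_notin[of _ S] by fastforce

lemma odd_count_le_length: "odd_count S \<le> length S"
proof -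
  have "odd_count S \<le> card (set S)"
    unfolding odd_count_def by (simp add: card_mono odd_count_set_subset)
  also have "\<dots> \<le> length S"
    by (rule card_length)
  finally show ?thesis .
qed

text \<open>Deleting two equal entries keeps the parity of every count and leaves a list shorter by
  2, whose length bounds \<open>odd_count\<close>.\<close>

lemma odd_count_not_distinct:
  assumes "\<not> distinct S"
  shows "odd_count S + 2 \<le> length S"
proof -
  obtain xs ys zs a where S: "S = xs @ [a] @ ys @ [a] @ zs"
    using not_distinct_decomp[OF assms] by blast
  have "odd_count S = odd_count (xs @ ys @ zs)"
    unfolding odd_count_def S by (rule arg_cong[where f = card]) auto
  also have "\<dots> \<le> length (xs @ ys @ zs)"
    by (rule odd_count_le_length)
  finally show ?thesis
    by (simp add: S)
qed

lemma count_list_distinct: "distinct S \<Longrightarrow> count_list S t = (if t \<in> set S then 1 else 0)"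
  by (induction S) auto

text \<open>The elements of odd count form the symmetric difference, so \<open>odd_count\<close> is
  the size of the union minus that of the intersection, while the two lengths add up to the sum of
  these sizes.\<close>

lemma odd_count_append_distinct:
  assumes "distinct A" "distinct B"
  shows "odd_count (A @ B) + length A + length B = 2 * card (set A \<union> set B)"
proof -
  have "{t. odd (count_list (A @ B) t)} = (set A \<union> set B) - (set A \<inter> set B)"
    using assms by (auto simp: count_list_distinct)
  then have "odd_count (A @ B) = card (set A \<union> set B) - card (set A \<inter> set B)"
    unfolding odd_count_def by (simp add: card_Diff_subset inf.coboundedI1)
  moreover have "card (set A \<inter> set B) \<le> card (set A \<union> set B)"
    by (rule card_mono) auto
  moreover have "length A + length B = card (set A \<union> set B) + card (set A \<inter> set B)"
    using card_Un_Int[of "set A" "set B"] assms by (simp add: distinct_card)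
  ultimately show ?thesis
    by linarith
qed

section \<open>Cyclic segments\<close>

lemma length_segment: "m \<le> length T \<Longrightarrow> length (segment T r m) = m"
  by (simp add: segment_def)

lemma segment_add:
  assumes "a + b \<le> length T"
  shows "segment T r (a + b) = segment T r a @ segment T (r + a) b"
proof (rule nth_equalityI)
  fix i assume "i < length (segment T r (a + b))"
  then have "i < a + b"
    using assms by (simp add: length_segment)
  then show "segment T r (a + b) ! i = (segment T r a @ segment T (r + a) b) ! i"
    using assms by (auto simp: segment_def nth_append nth_rotate)
qed (use assms in \<open>simp add: length_segment\<close>)

lemma segment_one: "T \<noteq> [] \<Longrightarrow> segment T r 1 = [T ! (r mod length T)]"
  by (auto simp: segment_def take_Suc hd_rotate_conv_nth)

lemma distinct_segment_mono: "distinct (segment T r n) \<Longrightarrow> m \<le> n \<Longrightarrow> distinct (segment T r m)"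
  by (metis distinct_take min.absorb1 segment_def take_take)

section \<open>Transitions and coordinate changes along a circuit\<close>

lemma length_transitions: "length (transitions C) = length C"
  by (simp add: transitions_def cyclic_steps_def)

lemma length_cyclic_steps: "length (cyclic_steps C) = length C"
  by (simp add: cyclic_steps_def)

lemma cyclic_steps_nth:
  "i < length C \<Longrightarrow> cyclic_steps C ! i = (C ! i, C ! (Suc i mod length C))"
  by (simp add: cyclic_steps_def nth_rotate1)

lemma set_cyclic_steps:
  "set (cyclic_steps C) = (\<lambda>i. (C ! i, C ! (Suc i mod length C))) ` {..<length C}"
proof -
  have "set (cyclic_steps C) = (\<lambda>i. cyclic_steps C ! i) ` {..<length C}"
    by (auto simp: set_conv_nth length_cyclic_steps)
  also have "\<dots> = (\<lambda>i. (C ! i, C ! (Suc i mod length C))) ` {..<length C}"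
    by (rule image_cong) (simp_all add: cyclic_steps_nth)
  finally show ?thesis .
qed

lemma transitions_nth:
  assumes "circuit d C" "i < length C"
  shows "(C ! i) p \<noteq> (C ! (Suc i mod length C)) p \<longleftrightarrow> p = transitions C ! i"
proof -
  have "(C ! i, C ! (Suc i mod length C)) \<in> hypercube d"
    using assms by (auto simp: circuit_def set_cyclic_steps)
  then have ex: "\<exists>!p. (C ! i) p \<noteq> (C ! (Suc i mod length C)) p"
    by (simp add: hypercube_def)
  have "transitions C ! i = (THE p. (C ! i) p \<noteq> (C ! (Suc i mod length C)) p)"
    using assms(2) by (simp add: transitions_def cyclic_steps_nth length_cyclic_steps)
  then show ?thesis
    using theI'[OF ex] ex by metis
qed

lemma circuit_nth_binary:
  assumes "circuit d C" "i < length C"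
  shows "C ! i \<in> binary_vectors d"
  using assms by (auto simp: circuit_def set_cyclic_steps hypercube_def)

lemma set_transitions:
  assumes "circuit d C"
  shows "set (transitions C) \<subseteq> {1..d}"
proof
  fix t assume "t \<in> set (transitions C)"
  then obtain i where i: "i < length C" "t = transitions C ! i"
    by (auto simp: in_set_conv_nth length_transitions)
  then have "(C ! i) t \<noteq> (C ! (Suc i mod length C)) t"
    using transitions_nth[OF assms] by blast
  moreover have "C ! i \<in> binary_vectors d" "C ! (Suc i mod length C) \<in> binary_vectors d"
    using circuit_nth_binary[OF assms] i(1) by (auto intro!: mod_less_divisor simp del: length_greater_0_conv)
  ultimately show "t \<in> {1..d}"
    by (metis PiE_arb binary_vectors_def)
qed

lemma binary_vectors_range:
  assumes "x \<in> binary_vectors d"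
  shows "x p \<in> (if p \<in> {1..d} then {0, 1} else {undefined})"
  using assms PiE_mem[of x "{1..d}" "\<lambda>_. {0, 1}" p] PiE_arb[of x "{1..d}" "\<lambda>_. {0, 1}" p]
  by (simp add: binary_vectors_def)

text \<open>A coordinate in \<open>{1..d}\<close> has only two possible values, and any other is
  \<open>undefined\<close> throughout, so disagreements compose as exclusive or.\<close>

lemma binary_vectors_neq_trans:
  assumes "x \<in> binary_vectors d" "y \<in> binary_vectors d" "z \<in> binary_vectors d"
  shows "x p \<noteq> z p \<longleftrightarrow> (x p \<noteq> y p) \<noteq> (y p \<noteq> z p)"
  using assms[THEN binary_vectors_range, of p] by (auto split: if_splits)

text \<open>Each occurrence of \<open>p\<close> in the segment flips coordinate \<open>p\<close>
  once, so only the parity matters. Hence \<open>odd_count\<close> of a segment is the Hamming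
  distance between its end vertices.\<close>

lemma circuit_diff_segment:
  assumes C: "circuit d C" and "m \<le> length C"
  shows "(C ! (r mod length C)) p \<noteq> (C ! ((r + m) mod length C)) p \<longleftrightarrow>
    odd (count_list (segment (transitions C) r m) p)"
  using assms(2)
proof (induction m)
  case 0
  show ?case by (simp add: segment_def)
next
  case (Suc m)
  let ?N = "length C" and ?T = "transitions C"
  have N: "?N > 0" "?T \<noteq> []"
    using Suc.prems length_transitions[of C] by auto
  have seg: "segment ?T r (Suc m) = segment ?T r m @ [?T ! ((r + m) mod ?N)]"
    using segment_add[of m 1 ?T r] segment_one[of ?T "r + m"] Suc.prems N
    by (simp add: length_transitions)
  have step: "(C ! ((r + m) mod ?N)) p \<noteq> (C ! ((r + Suc m) mod ?N)) p \<longleftrightarrow> p = ?T ! ((r + m) mod ?N)"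
    using transitions_nth[OF C, of "(r + m) mod ?N" p] N by (simp add: mod_Suc_eq)
  have "C ! (i mod ?N) \<in> binary_vectors d" for i
    using circuit_nth_binary[OF C] N by simp
  then have "(C ! (r mod ?N)) p \<noteq> (C ! ((r + Suc m) mod ?N)) p \<longleftrightarrow>
      ((C ! (r mod ?N)) p \<noteq> (C ! ((r + m) mod ?N)) p) \<noteq>
      ((C ! ((r + m) mod ?N)) p \<noteq> (C ! ((r + Suc m) mod ?N)) p)"
    by (intro binary_vectors_neq_trans)
  then show ?case
    using Suc step by (auto simp: seg)
qed

section \<open>Distances in the hypercube and along a circuit\<close>

lemma hypercube_relpow:
  assumes "x \<in> binary_vectors d" "y \<in> binary_vectors d"
    and "finite {p. x p \<noteq> y p}"
  shows "(x, y) \<in> hypercube d ^^ card {p. x p \<noteq> y p}"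
  using assms
proof (induction "card {p. x p \<noteq> y p}" arbitrary: x)
  case 0
  then have "x = y" by auto
  then show ?case by simp
next
  case (Suc n)
  then obtain q where q: "x q \<noteq> y q"
    by (metis (mono_tags, lifting) card.empty empty_Collect_eq nat.simps(3))
  \<comment> \<open>Correcting one wrong coordinate is one edge of the cube and leaves one
    difference fewer.\<close>
  define z where "z = x(q := y q)"
  have qd: "q \<in> {1..d}"
    using q Suc.prems by (metis PiE_arb binary_vectors_def)
  then have z: "z \<in> binary_vectors d"
    using Suc.prems unfolding z_def binary_vectors_def
    by (auto simp: PiE_iff extensional_def)
  have diff: "{p. x p \<noteq> y p} = insert q {p. z p \<noteq> y p}" "q \<notin> {p. z p \<noteq> y p}"
    using q by (auto simp: z_def)
  have fin: "finite {p. z p \<noteq> y p}"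
    using Suc.prems(3) diff by simp
  have card: "n = card {p. z p \<noteq> y p}"
    using Suc.hyps(2) diff fin by simp
  have "(x, z) \<in> hypercube d"
    using z Suc.prems q by (auto simp: hypercube_def z_def)
  moreover have "(z, y) \<in> hypercube d ^^ n"
    using Suc.hyps(1)[OF card z Suc.prems(2) fin] card by simp
  ultimately show ?case
    unfolding Suc.hyps(2)[symmetric] by (rule relpow_Suc_I2)
qed

text \<open>Every edge moves the index by 1 or -1 modulo \<open>length C\<close>, and distinctness
  makes the index of a vertex unique. The witness \<open>s\<close> is the net displacement of the
  walk, negative if it goes backwards.\<close>

lemma cycle_graph_relpow_shift:
  assumes "(C ! i, y) \<in> cycle_graph C ^^ n" "distinct C" "i < length C"
  shows "\<exists>j s. j < length C \<and> y = C ! j \<and> \<bar>s\<bar> \<le> int n \<and> [int j = int i + s] (mod int (length C))"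
  using assms(1)
proof (induction n arbitrary: y)
  case 0
  then show ?case using assms(3) by (intro exI[of _ i] exI[of _ 0]) auto
next
  case (Suc n)
  let ?N = "length C"
  from Suc.prems obtain w where w: "(C ! i, w) \<in> cycle_graph C ^^ n" "(w, y) \<in> cycle_graph C"
    by auto
  from Suc.IH[OF w(1)] obtain j s where j: "j < ?N" "w = C ! j" "\<bar>s\<bar> \<le> int n"
    "[int j = int i + s] (mod int ?N)" by blast
  from w(2) consider (fwd) a where "a < ?N" "w = C ! a" "y = C ! (Suc a mod ?N)"
    | (bwd) a where "a < ?N" "y = C ! a" "w = C ! (Suc a mod ?N)"
    by (auto simp: cycle_graph_def set_cyclic_steps)
  then show ?case
  proof cases
    case fwd
    then have a: "a = j"
      using j assms(2) nth_eq_iff_index_eq by blast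
    have "[int (Suc j mod ?N) = int j + 1] (mod int ?N)"
      by (simp add: cong_def zmod_int add.commute)
    also have "[int j + 1 = int i + (s + 1)] (mod int ?N)"
      using cong_add[OF j(4) cong_refl[of 1]] by (simp add: add.assoc)
    finally show ?thesis
      using fwd a j by (intro exI[of _ "Suc j mod ?N"] exI[of _ "s + 1"])
        (auto intro: mod_less_divisor)
  next
    case bwd
    then have "Suc a mod ?N = j"
      using j assms(2) nth_eq_iff_index_eq[of C "Suc a mod ?N" j] by (metis mod_less_divisor gr_zeroI not_less0)
    then have "[int a + 1 = int j] (mod int ?N)"
      by (auto simp: cong_def zmod_int add.commute)
    then have "[int a + 1 = int i + s] (mod int ?N)"
      using j(4) cong_trans by blast
    then have "[int a = int i + (s - 1)] (mod int ?N)"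
      using cong_diff[of "int a + 1" "int i + s" "int ?N" 1 1] by (simp add: algebra_simps)
    then show ?thesis
      using bwd j(3) by (intro exI[of _ a] exI[of _ "s - 1"]) auto
  qed
qed

text \<open>This walk makes the \<open>LEAST\<close> in \<open>graph_dist\<close> meaningful: the
  circuit distance is attained.\<close>

lemma cycle_graph_relpow:
  assumes "C \<noteq> []"
  shows "(C ! (r mod length C), C ! ((r + m) mod length C)) \<in> cycle_graph C ^^ m"
proof (induction m)
  case (Suc m)
  have "(C ! ((r + m) mod length C), C ! ((r + Suc m) mod length C)) \<in> set (cyclic_steps C)"
    using assms unfolding set_cyclic_steps
    by (intro image_eqI[of _ _ "(r + m) mod length C"]) (auto simp: mod_Suc_eq)
  with Suc show ?case
    by (auto simp: cycle_graph_def)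
qed simp

text \<open>A walk between the two vertices has net displacement congruent to \<open>m\<close>
  modulo \<open>length C\<close>, and \<open>m\<close> is at least \<open>k\<close> away from every
  multiple of \<open>length C\<close>.\<close>

lemma cycle_graph_dist_ge:
  assumes "distinct C" "k \<le> m" "m + k \<le> length C" "C \<noteq> []"
  shows "k \<le> graph_dist (cycle_graph C) (C ! (r mod length C)) (C ! ((r + m) mod length C))"
proof -
  let ?N = "length C"
  let ?n = "graph_dist (cycle_graph C) (C ! (r mod ?N)) (C ! ((r + m) mod ?N))"
  have "(C ! (r mod ?N), C ! ((r + m) mod ?N)) \<in> cycle_graph C ^^ ?n"
    unfolding graph_dist_def by (rule LeastI) (rule cycle_graph_relpow[OF assms(4)])
  then obtain j s where j: "j < ?N" "C ! ((r + m) mod ?N) = C ! j" "\<bar>s\<bar> \<le> int ?n"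
    "[int j = int (r mod ?N) + s] (mod int ?N)"
    using cycle_graph_relpow_shift[of C "r mod ?N"] assms by (metis length_greater_0_conv mod_less_divisor)
  have "j = (r + m) mod ?N"
    using j(1,2) assms(1,4) nth_eq_iff_index_eq by (metis length_greater_0_conv mod_less_divisor)
  then have "[int r + int m = int r + s] (mod int ?N)"
    using j(4) by (simp add: cong_def zmod_int mod_add_left_eq)
  then have "int ?N dvd int m - s"
    by (metis add_diff_cancel_left cong_iff_dvd_diff)
  then obtain q where q: "int m - s = int ?N * q" by blast
  \<comment> \<open>Here \<open>s = m - length C * q\<close>, which is at least \<open>m\<close> for
    \<open>q \<le> 0\<close> and at most \<open>m - length C \<le> -k\<close> for
    \<open>q \<ge> 1\<close>.\<close>
  have "int k \<le> \<bar>s\<bar>"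
  proof (cases "q \<le> 0")
    case True
    then have "int ?N * q \<le> 0" by (simp add: mult_nonneg_nonpos)
    then show ?thesis using q assms(2) by linarith
  next
    case False
    then have "int ?N * 1 \<le> int ?N * q" by (intro mult_left_mono) auto
    then show ?thesis using q assms(3) by linarith
  qed
  then show ?thesis using j(3) by linarith
qed

section \<open>Spread as a lower bound on parity counts\<close>

lemma circuit_code_odd_count_ge:
  assumes "circuit_code d k C" "k \<le> m" "m + k \<le> length C"
  shows "k \<le> odd_count (segment (transitions C) r m)"
proof (rule ccontr)
  let ?N = "length C" and ?S = "segment (transitions C) r m"
  let ?x = "C ! (r mod ?N)" and ?y = "C ! ((r + m) mod ?N)"
  assume "\<not> k \<le> odd_count ?S"
  have C: "circuit d C" "distinct C" and N: "0 < ?N" "C \<noteq> []"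
    using assms(1) by (auto simp: circuit_code_def circuit_def)
  have diff: "{p. ?x p \<noteq> ?y p} = {p. odd (count_list ?S p)}"
    using circuit_diff_segment[OF C(1), of m r] assms(3) by auto
  \<comment> \<open>This walk bounds the cube distance by \<open>odd_count ?S\<close>, hence below
    \<open>k\<close>; the spread condition carries the bound over to the circuit distance.\<close>
  have "(?x, ?y) \<in> hypercube d ^^ odd_count ?S"
    unfolding odd_count_def diff[symmetric]
    using N diff by (intro hypercube_relpow circuit_nth_binary[OF C(1)])
      (auto intro: finite_subset[OF odd_count_set_subset])
  then have "graph_dist (hypercube d) ?x ?y \<le> odd_count ?S"
    unfolding graph_dist_def by (rule Least_le)
  then have less: "graph_dist (hypercube d) ?x ?y < k"
    using \<open>\<not> k \<le> odd_count ?S\<close> by simp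
  moreover have "?x \<in> set C" "?y \<in> set C"
    using N by auto
  ultimately have "graph_dist (cycle_graph C) ?x ?y < k"
    using assms(1) unfolding circuit_code_def by metis
  then show False
    using cycle_graph_dist_ge[OF C(2) assms(2,3) N(2), of r] by simp
qed

theorem lemma3p5:
  fixes k l d :: nat and C :: "(nat \<Rightarrow> nat) list"
  assumes "k \<ge> 1"
    and "(even k \<and> odd l) \<or> (odd k \<and> even l)"
    and "real d = 3 * real k / 2 + (real l + 1) / 2"
    and "C \<in> code_family d k (k + l)"
    and "length C > 2 * d"
  shows "min_bit_run C = k + 1 \<and>
    (\<forall>r. distinct (segment (transitions C) r (k + l)) \<longrightarrow>
       odd_count (segment (transitions C) r (2 * k + l + 1)) = k \<and>
       set (segment (transitions C) r (2 * k + l + 1)) = {1..d})"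
proof -
  let ?T = "transitions C" and ?N = "length C"
  have d: "2 * d = 3 * k + l + 1"
    using assms(3) by (simp add: field_simps flip: of_nat_eq_iff[where 'a = real])
  have code: "circuit_code d k C" and run: "k + l \<le> max_bit_run C"
    using assms(4) by (auto simp: code_family_def)
  have len: "length (segment ?T r m) = m" if "m \<le> ?N" for r m
    using that by (simp add: length_segment length_transitions)
  have sub: "set (segment ?T r m) \<subseteq> {1..d}" for r m
    using set_transitions[of d C] code set_take_subset[of m "rotate r ?T"]
    by (auto simp: circuit_code_def segment_def)
  \<comment> \<open>A repetition would push \<open>odd_count\<close> down to at most
    \<open>k - 1\<close>, against the spread bound, which applies since
    \<open>(k + 1) + k \<le> length C\<close>.\<close>
  have distinct_Suc: "distinct (segment ?T r (k + 1))" for r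
  proof (rule ccontr)
    assume "\<not> distinct (segment ?T r (k + 1))"
    then have "odd_count (segment ?T r (k + 1)) + 2 \<le> k + 1"
      using odd_count_not_distinct len[of "k + 1" r] d assms(5) by fastforce
    then show False
      using circuit_code_odd_count_ge[OF code, of "k + 1" r] d assms(5) by linarith
  qed
  have split: "odd_count (segment ?T r (k + l + m)) + (k + l + m)
      = 2 * card (set (segment ?T r (k + l + m)))"
    if "distinct (segment ?T r (k + l))" "distinct (segment ?T (r + (k + l)) m)"
      "k + l + m \<le> ?N" for r m
    using odd_count_append_distinct[OF that(1,2)] segment_add[of "k + l" m ?T r] that(3)
    by (simp add: length_transitions len)
  have card_le: "card (set (segment ?T r m)) \<le> d" for r m
    using card_mono[OF _ sub] by simp
  have "odd_count (segment ?T r (2 * k + l + 1)) = k \<and> set (segment ?T r (2 * k + l + 1)) = {1..d}"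
    if "distinct (segment ?T r (k + l))" for r
  proof -
    have m: "k + l + (k + 1) = 2 * k + l + 1" by simp
    have "odd_count (segment ?T r (2 * k + l + 1)) + (2 * k + l + 1)
        = 2 * card (set (segment ?T r (2 * k + l + 1)))"
      using split[OF that distinct_Suc] d assms(5) unfolding m by simp
    moreover have "k \<le> odd_count (segment ?T r (2 * k + l + 1))"
      using d assms(5) by (intro circuit_code_odd_count_ge[OF code]) auto
    \<comment> \<open>As \<open>2 * d = 3 * k + l + 1\<close>, the identity gives
      \<open>odd_count\<close> at most \<open>k\<close>; equality with the lower bound then forces
      the cardinality up to \<open>d\<close>.\<close>
    ultimately have "odd_count (segment ?T r (2 * k + l + 1)) = k"
      "card (set (segment ?T r (2 * k + l + 1))) = d"
      using card_le[of r "2 * k + l + 1"] d by linarith+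
    then show ?thesis
      using card_subset_eq[OF _ sub] by simp
  qed
  moreover have "min_bit_run C = k + 1"
    unfolding min_bit_run_def
  proof (rule Max_eqI)
    show "finite {m. m \<le> ?N \<and> (\<forall>r. distinct (segment ?T r m))}"
      by simp
    show "k + 1 \<in> {m. m \<le> ?N \<and> (\<forall>r. distinct (segment ?T r m))}"
      using distinct_Suc d assms(5) by simp
    fix m assume "m \<in> {m. m \<le> ?N \<and> (\<forall>r. distinct (segment ?T r m))}"
    then have m: "\<And>r. distinct (segment ?T r m)" by simp
    show "m \<le> k + 1"
    proof (rule ccontr)
      assume "\<not> m \<le> k + 1"
      then have B: "distinct (segment ?T r (k + 2))" for r
        using distinct_segment_mono[OF m] by simp
      \<comment> \<open>The maximum is attained, and a prefix of a longest run is a repetition-free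
        segment of length exactly \<open>k + l\<close>.\<close>
      have "max_bit_run C \<in> {m. m \<le> ?N \<and> (\<exists>r. distinct (segment ?T r m))}"
        unfolding max_bit_run_def
      proof (rule Max_in)
        have "0 \<in> {m. m \<le> ?N \<and> (\<exists>r. distinct (segment ?T r m))}"
          by (simp add: segment_def)
        then show "{m. m \<le> ?N \<and> (\<exists>r. distinct (segment ?T r m))} \<noteq> {}"
          by blast
      qed simp
      then obtain r where r: "distinct (segment ?T r (k + l))"
        using distinct_segment_mono run by blast
      \<comment> \<open>This leaves at most \<open>k - 1\<close> for \<open>odd_count\<close>. The
        spread bound still applies, because \<open>(2 * k + l + 2) + k = 2 * d + 1\<close>, exactly
        the length that \<open>length C > 2 * d\<close> guarantees.\<close>
      have "odd_count (segment ?T r (k + l + (k + 2))) + (k + l + (k + 2)) \<le> 2 * d"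
        using split[OF r B] card_le[of r "k + l + (k + 2)"] d assms(5) by simp
      moreover have "k \<le> odd_count (segment ?T r (k + l + (k + 2)))"
        using d assms(5) by (intro circuit_code_odd_count_ge[OF code]) auto
      ultimately show False
        using d by linarith
    qed
  qed
  ultimately show ?thesis by blast
qed

end
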